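(* Let $C_1,\dots,C_K\subset\mathbb{R}^N$ and $C=\bigcap_{k=1}^K C_k$ be the coefficient constraint sets associated with the constraint families $(L_k,r_k,\omega_k)_{k=1}^K$ (as defined in the context). Then $C$ is a closed convex set in $\mathbb{R}^N$, and for each $k=1,\dots,K$, $C_k$ is a closed, affine convex cone in $\mathbb{R}^N$ with vertex located at $\widehat{\boldsymbol r}_k$.
   Context: Let $\Omega\subset\mathbb{R}^d$ ($d\ge 1$), and let $H$ be a real Hilbert space of scalar-valued functions on $\Omega$ with inner product $\langle\cdot,\cdot\rangle$. Let $V\subset H$ be an $N$-dimensional subspace with orthonormal basis $v_1,\dots,v_N$, and let $V^\ast$ be its dual, with the operator norm. For $k=1,\dots,K$ a constraint family is a tuple $(L_k,r_k,\omega_k)$, where $\omega_k\subset\Omega$, $r_k\in V$, and for each $y\in\omega_k$, $L_k(\cdot,y)$ is an element of $V^\ast$ of unit norm. Define $$E_k=\{v\in V : L_k(v,y)\le L_k(r_k,y)\text{ for all }y\in\omega_k\},\qquad E=\bigcap_{k=1}^K E_k,$$ and assume that $E$ is nonempty. The corresponding sets of coefficient vectors are $$C_k=\Big\{\boldsymbol c\in\mathbb{R}^N : \sum_{j=1}^N c_jv_j\in E_k\Big\},\qquad C=\bigcap_{k=1}^K C_k .$$ The vector $\widehat{\boldsymbol r}_k=(\widehat r_{k,1},\dots,\widehat r_{k,N})^T\in\mathbb{R}^N$ is the coefficient vector of $r_k$, i.e. $r_k=\sum_{j=1}^N\widehat r_{k,j}v_j$. A set $D\subset\mathbb{R}^N$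 is a convex cone if $ax+by\in D$ for all $x,y\in D$ and all $a,b\ge 0$. A set is an affine convex cone with vertex $z\in\mathbb{R}^N$ if it equals $D+z$ for some convex cone $D$. *)

theory Defs
  imports "HOL-Analysis.Analysis"
begin

text \<open>
  A real Hilbert space of real-valued functions on \<open>\<Omega>\<close> is a type \<open>'h\<close> of the classes
  \<open>real_inner\<close> and \<open>complete_space\<close> together with the values \<open>ev f x\<close> of its elements: the
  vector space operations are pointwise and an element is determined by its values on \<open>\<Omega>\<close>.
  Point evaluation need not be continuous.
\<close>

definition function_space_on ::
  "'a set \<Rightarrow> ('h::real_vector \<Rightarrow> 'a \<Rightarrow> real) \<Rightarrow> bool" where
  "function_space_on \<Omega> ev \<longleftrightarrow>
     (\<forall>f g. \<forall>x\<in>\<Omega>. ev (f + g) x = ev f x + ev g x) \<and>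
     (\<forall>a f. \<forall>x\<in>\<Omega>. ev (a *\<^sub>R f) x = a * ev f x) \<and>
     (\<forall>f g. (\<forall>x\<in>\<Omega>. ev f x = ev g x) \<longrightarrow> f = g)"

definition orthonormal_basis_of :: "'h::real_inner set \<Rightarrow> ('n \<Rightarrow> 'h) \<Rightarrow> bool" where
  "orthonormal_basis_of V v \<longleftrightarrow>
     (\<forall>i j. inner (v i) (v j) = (if i = j then 1 else 0)) \<and> span (range v) = V"

text \<open>
  A functional on the subspace \<open>V\<close> is represented by a function on the whole type of which
  only the values on \<open>V\<close> are constrained.
\<close>

definition dual_space :: "'h::real_normed_vector set \<Rightarrow> ('h \<Rightarrow> real) set" where
  "dual_space V = {\<phi>.
     (\<forall>u\<in>V. \<forall>v\<in>V. \<phi> (u + v) = \<phi> u + \<phi> v) \<and>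
     (\<forall>a. \<forall>v\<in>V. \<phi> (a *\<^sub>R v) = a * \<phi> v) \<and>
     (\<exists>B. \<forall>v\<in>V. \<bar>\<phi> v\<bar> \<le> B * norm v)}"

text \<open>As in \<^const>\<open>onorm\<close>, the vector \<open>0\<close> contributes the quotient \<open>0 / 0 = 0\<close>.\<close>

definition dual_norm :: "'h::real_normed_vector set \<Rightarrow> ('h \<Rightarrow> real) \<Rightarrow> real" where
  "dual_norm V \<phi> = (SUP v\<in>V. \<bar>\<phi> v\<bar> / norm v)"

definition constraint_family ::
  "'a set \<Rightarrow> 'h::real_normed_vector set \<Rightarrow> ('h \<Rightarrow> 'a \<Rightarrow> real) \<Rightarrow> 'h \<Rightarrow> 'a set \<Rightarrow> bool" where
  "constraint_family \<Omega> V L r \<omega> \<longleftrightarrow>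
     \<omega> \<subseteq> \<Omega> \<and> r \<in> V \<and>
     (\<forall>y\<in>\<omega>. (\<lambda>v. L v y) \<in> dual_space V \<and> dual_norm V (\<lambda>v. L v y) = 1)"

definition constraint_set ::
  "'h set \<Rightarrow> ('h \<Rightarrow> 'a \<Rightarrow> real) \<Rightarrow> 'h \<Rightarrow> 'a set \<Rightarrow> 'h set" where
  "constraint_set V L r \<omega> = {v\<in>V. \<forall>y\<in>\<omega>. L v y \<le> L r y}"

definition coeff_set :: "('n::finite \<Rightarrow> 'h::real_vector) \<Rightarrow> 'h set \<Rightarrow> (real ^ 'n) set" where
  "coeff_set v E = {c. (\<Sum>j\<in>UNIV. (c $ j) *\<^sub>R v j) \<in> E}"

text \<open>
  Unlike the library's \<^const>\<open>convex_cone\<close>, the following condition does not require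
  nonemptiness.
\<close>

definition is_convex_cone :: "'b::real_vector set \<Rightarrow> bool" where
  "is_convex_cone D \<longleftrightarrow>
     (\<forall>x\<in>D. \<forall>y\<in>D. \<forall>a b. 0 \<le> a \<longrightarrow> 0 \<le> b \<longrightarrow> a *\<^sub>R x + b *\<^sub>R y \<in> D)"

definition affine_convex_cone :: "'b::real_vector \<Rightarrow> 'b set \<Rightarrow> bool" where
  "affine_convex_cone z S \<longleftrightarrow> (\<exists>D. is_convex_cone D \<and> S = (\<lambda>x. x + z) ` D)"

end

theory Submission
  imports Defs
begin

text \<open>
  A functional \<open>\<phi>\<close> on \<open>V\<close> acts on the element with coefficient vector \<open>c\<close> as the inner
  product of \<open>c\<close> with the vector of the values \<open>\<phi> (v j)\<close>. Hence each pointwise constraint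
  \<open>L u y \<le> L r y\<close> becomes, for the coefficient vector, a closed half-space whose bounding
  hyperplane passes through the coefficient vector \<open>z\<close> of \<open>r\<close>
  (\<open>coeff_set_eq_halfspaces\<close>). So each \<open>C k\<close> is a possibly infinite intersection of closed
  half-spaces with \<open>rhat k\<close> on all of their boundaries: it is closed, and its translate by
  \<open>- rhat k\<close> is an intersection of homogeneous half-spaces, which is a convex cone
  (\<open>affine_convex_cone_halfspaces\<close>). Translates of convex cones are convex, and closedness
  and convexity pass to the intersection over \<open>k\<close>.
\<close>

text \<open>
  A member of \<open>dual_space V\<close> is additive only on \<open>V\<close>, so facts about linear
  maps do not apply to it; the induction has to carry along that partial sums stay in \<open>V\<close>.
\<close>

lemma dual_space_sum_scaleR:
  assumes "subspace V" and "\<phi> \<in> dual_space V"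
    and "finite I" and "\<And>j. j \<in> I \<Longrightarrow> v j \<in> V"
  shows "\<phi> (\<Sum>j\<in>I. f j *\<^sub>R v j) = (\<Sum>j\<in>I. f j * \<phi> (v j))"
  using assms(3,4)
proof (induction I rule: finite_induct)
  case empty
  have "\<phi> (0 *\<^sub>R 0) = 0 * \<phi> 0"
    using assms(1,2) unfolding dual_space_def by (blast intro: subspace_0)
  then show ?case by simp
next
  case (insert i I)
  have "f i *\<^sub>R v i \<in> V" "(\<Sum>j\<in>I. f j *\<^sub>R v j) \<in> V"
    using insert.prems assms(1) by (auto intro: subspace_sum subspace_scale)
  then have "\<phi> (f i *\<^sub>R v i + (\<Sum>j\<in>I. f j *\<^sub>R v j))
      = \<phi> (f i *\<^sub>R v i) + \<phi> (\<Sum>j\<in>I. f j *\<^sub>R v j)"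
    using assms(2) unfolding dual_space_def by blast
  moreover have "\<phi> (f i *\<^sub>R v i) = f i * \<phi> (v i)"
    using assms(2) insert.prems unfolding dual_space_def by blast
  ultimately show ?case
    using insert by simp
qed

lemma coeff_set_eq_halfspaces:
  fixes v :: "'n::finite \<Rightarrow> 'h::real_normed_vector"
  assumes V: "subspace V" "\<And>j. v j \<in> V"
    and L: "\<And>y. y \<in> \<omega> \<Longrightarrow> (\<lambda>u. L u y) \<in> dual_space V"
    and r: "r = (\<Sum>j\<in>UNIV. (z $ j) *\<^sub>R v j)"
  shows "coeff_set v (constraint_set V L r \<omega>) =
    (\<Inter>a\<in>(\<lambda>y. \<chi> j. L (v j) y) ` \<omega>. {c. inner a c \<le> inner a z})"
proof -
  have "L (\<Sum>j\<in>UNIV. (c $ j) *\<^sub>R v j) y = inner (\<chi> j. L (v j) y) c"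
    if "y \<in> \<omega>" for c y
    using dual_space_sum_scaleR[OF V(1) L[OF that] finite, where v = v and f = "\<lambda>j. c $ j"] V(2)
    by (simp add: inner_vec_def mult.commute)
  moreover have "(\<Sum>j\<in>UNIV. (c $ j) *\<^sub>R v j) \<in> V" for c
    using V by (intro subspace_sum subspace_scale)
  ultimately show ?thesis
    by (auto simp: coeff_set_def constraint_set_def r)
qed

lemma affine_convex_cone_halfspaces:
  fixes z :: "'b::real_inner"
  shows "affine_convex_cone z (\<Inter>a\<in>A. {c. inner a c \<le> inner a z})"
proof -
  define D where "D = {x. \<forall>a\<in>A. inner a x \<le> 0}"
  have "is_convex_cone D"
    unfolding is_convex_cone_def D_def
    by (auto simp: inner_add_right intro!: add_nonpos_nonpos mult_nonneg_nonpos)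
  moreover have "(\<Inter>a\<in>A. {c. inner a c \<le> inner a z}) = (\<lambda>x. x + z) ` D"
  proof (rule equalityI; rule subsetI)
    fix c assume "c \<in> (\<Inter>a\<in>A. {c. inner a c \<le> inner a z})"
    then have "c - z \<in> D"
      by (auto simp: D_def inner_diff_right)
    then show "c \<in> (\<lambda>x. x + z) ` D"
      by (rule rev_image_eqI) simp
  qed (auto simp: D_def inner_add_right)
  ultimately show ?thesis
    unfolding affine_convex_cone_def by blast
qed

lemma affine_convex_cone_imp_convex:
  assumes "affine_convex_cone z S"
  shows "convex S"
proof -
  obtain D where D: "is_convex_cone D" and S: "S = (\<lambda>x. x + z) ` D"
    using assms unfolding affine_convex_cone_def by blast
  have "convex D"
    using D unfolding convex_def is_convex_cone_def by blast
  then have "convex ((\<lambda>x. z + x) ` D)"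
    by (rule convex_translation)
  then show ?thesis
    by (simp add: S add.commute)
qed

theorem theorem3p1:
  fixes \<Omega> :: "(real ^ 'd) set"
    and ev :: "'h::{real_inner, complete_space} \<Rightarrow> real ^ 'd \<Rightarrow> real"
    and V :: "'h set"
    and v :: "'n::finite \<Rightarrow> 'h"
    and K :: nat
    and L :: "nat \<Rightarrow> 'h \<Rightarrow> real ^ 'd \<Rightarrow> real"
    and r :: "nat \<Rightarrow> 'h"
    and \<omega> :: "nat \<Rightarrow> (real ^ 'd) set"
    and rhat :: "nat \<Rightarrow> real ^ 'n"
    and E :: "nat \<Rightarrow> 'h set"
    and C :: "nat \<Rightarrow> (real ^ 'n) set"
  assumes "function_space_on \<Omega> ev"
    and "subspace V" and "dim V = CARD('n)"
    and "orthonormal_basis_of V v"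
    and "\<And>k. k \<in> {1..K} \<Longrightarrow> constraint_family \<Omega> V (L k) (r k) (\<omega> k)"
    and "\<And>k. k \<in> {1..K} \<Longrightarrow> E k = constraint_set V (L k) (r k) (\<omega> k)"
    and "(\<Inter>k\<in>{1..K}. E k) \<noteq> {}"
    and "\<And>k. k \<in> {1..K} \<Longrightarrow> C k = coeff_set v (E k)"
    and "\<And>k. k \<in> {1..K} \<Longrightarrow> r k = (\<Sum>j\<in>UNIV. (rhat k $ j) *\<^sub>R v j)"
  shows "closed (\<Inter>k\<in>{1..K}. C k) \<and> convex (\<Inter>k\<in>{1..K}. C k) \<and>
    (\<forall>k\<in>{1..K}. closed (C k) \<and> affine_convex_cone (rhat k) (C k))"
proof -
  have v_in_V: "v j \<in> V" for j
    using assms(4) span_superset[of "range v"] unfolding orthonormal_basis_of_def by blast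
  have halfspaces: "C k =
      (\<Inter>a\<in>(\<lambda>y. \<chi> j. L k (v j) y) ` \<omega> k. {c. inner a c \<le> inner a (rhat k)})"
    if k: "k \<in> {1..K}" for k
    unfolding assms(8)[OF k] assms(6)[OF k]
    using assms(5)[OF k] assms(9)[OF k]
    by (intro coeff_set_eq_halfspaces[OF assms(2) v_in_V])
      (auto simp: constraint_family_def)
  have closed: "closed (C k)" if "k \<in> {1..K}" for k
    unfolding halfspaces[OF that] by (intro closed_INT ballI closed_halfspace_le)
  have cone: "affine_convex_cone (rhat k) (C k)" if "k \<in> {1..K}" for k
    unfolding halfspaces[OF that] by (rule affine_convex_cone_halfspaces)
  have "closed (\<Inter>k\<in>{1..K}. C k)"
    using closed by (intro closed_INT ballI)
  moreover have "convex (\<Inter>k\<in>{1..K}. C k)"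
    using cone by (intro convex_INT affine_convex_cone_imp_convex)
  ultimately show ?thesis
    using closed cone by blast
qed

end
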